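(* Let $G^{C_4}$ be a $4$-base-module with $C_4=v_1v_2v_3v_4v_1$, and let $f$ be a module-colouring of $G^{C_4}$ with $f(v_2)=f(v_4)=2$ and $f(v_1)=f(v_3)=1$, under which there are a $23$-module-path $\ell^{23}\in P^f_{23}(v_2,v_4)$ and a $24$-module-path $\ell^{24}\in P^f_{24}(v_2,v_4)$ that are parallel. If $d_{G^{C_4}}(v_2)=4$, then there exists $f^*\in C_4^0(G^{C_4})$ such that $f^*(v_2)\neq f^*(v_4)$.
   Context: A semi-maximal planar graph (SMPG) $G^C$ is a plane graph whose outer face is bounded by the cycle $C$ (length $\ge4$) and all other faces are triangles. Colours are $\{1,2,3,4\}$; $C_4^0(\cdot)$ denotes proper $4$-colourings up to permutation of colour names; $f(H)=\{f(v):v\in V(H)\}$; a bichromatic cycle of $f$ is a cycle $C$ with $|f(C)|=2$. If $f(C)=\{i,j\}$ and $\{s,t\}$ are the other colours, $\sigma(f,C)$ interchanges $s,t$ on all vertices in the interior of $C$; Kempe-equivalence is generated by $\sigma$-operations and $F^f(\cdot)$ is the Kempe class of $f$. For a $4$-chromatic maximal planar graph $G$ with $\delta(G)\ge4$, a bichromatic cycle $C$ of $f$ is a UB-cycle if $|f'(C)|=2$ for all $f'\in F^f(G)$, and $f$ is then a UBC-colouring with respect to $C$. An SMPG $G^C$ with $|C|=4$ is a $4$-base-module if there is an SMPG $G_1^C$ with $G^C\cap G_1^C=C$ (in the exterior of $C$) such that $G=G^C\cup G_1^C$ is a $4$-chromatic maximal planar graph with $\delta(G)\ge4$ having a UBC-colouring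 with respect to $C$; a module-colouring of $G^C$ is the restriction to $G^C$ of such a UBC-colouring. $P_{2i}^f(v_2,v_4)$ ($i\in\{3,4\}$) is the set of paths from $v_2$ to $v_4$ all of whose vertices have colours in $\{2,i\}$; its elements are the $2i$-module-paths. For such a path $\ell$, $H_1^{\ell}$ (resp. $H_2^{\ell}$) is the subgraph of $G^{C_4}$ induced by the vertices on and inside the cycle $v_4v_1v_2\cup\ell$ (resp. $v_4v_3v_2\cup\ell$). The paths $\ell^{23}$ and $\ell^{24}$ are parallel if exactly one of $H_1^{\ell^{23}},H_2^{\ell^{23}}$ contains no vertex of $V(\ell^{24})\setminus\{v_2,v_4\}$ and the other contains all vertices of $\ell^{24}$; otherwise they are intersecting. *)

theory Defs
  imports "HOL-Analysis.Analysis" "HOL-Combinatorics.Permutations"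
begin

section \<open>Plane graphs\<close>

text \<open>A plane graph is drawn: its vertices are points of the plane and each edge is the point set
  of an arc between two vertices.  Hence unions and intersections of graphs
  drawn in the same plane are unions and intersections of the vertex and edge sets.\<close>

record pgraph =
  verts :: "complex set"
  edges :: "complex set set"

definition joins :: "complex set \<Rightarrow> complex \<Rightarrow> complex \<Rightarrow> bool" where
  "joins e u v \<longleftrightarrow> (\<exists>g. arc g \<and> path_image g = e \<and> pathstart g = u \<and> pathfinish g = v)"

text \<open>An arc has distinct end points, so there are no loops.  As \<open>e \<inter> verts G\<close> is
  the set of end points of \<open>e\<close>, the third condition excludes multiple edges, and the last one says
  that two edges meet only in common end points.\<close>

definition plane_graph :: "pgraph \<Rightarrow> bool" where
  "plane_graph G \<longleftrightarrow>
     finite (verts G) \<and> finite (edges G) \<and>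
     (\<forall>e\<in>edges G. \<exists>u v. joins e u v \<and> e \<inter> verts G = {u, v}) \<and>
     (\<forall>e\<in>edges G. \<forall>e'\<in>edges G. e \<noteq> e' \<longrightarrow> e \<inter> verts G \<noteq> e' \<inter> verts G) \<and>
     (\<forall>e\<in>edges G. \<forall>e'\<in>edges G. e \<noteq> e' \<longrightarrow> e \<inter> e' \<subseteq> verts G)"

definition adj :: "pgraph \<Rightarrow> complex \<Rightarrow> complex \<Rightarrow> bool" where
  "adj G u v \<longleftrightarrow> u \<in> verts G \<and> v \<in> verts G \<and> (\<exists>e\<in>edges G. joins e u v)"

definition deg :: "pgraph \<Rightarrow> complex \<Rightarrow> nat" where
  "deg G v = card {u. adj G v u}"

definition graph_union :: "pgraph \<Rightarrow> pgraph \<Rightarrow> pgraph" where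
  "graph_union G H = \<lparr>verts = verts G \<union> verts H, edges = edges G \<union> edges H\<rparr>"

definition graph_inter :: "pgraph \<Rightarrow> pgraph \<Rightarrow> pgraph" where
  "graph_inter G H = \<lparr>verts = verts G \<inter> verts H, edges = edges G \<inter> edges H\<rparr>"

definition induced_subgraph :: "pgraph \<Rightarrow> complex set \<Rightarrow> pgraph" where
  "induced_subgraph G S =
     \<lparr>verts = verts G \<inter> S, edges = {e \<in> edges G. e \<inter> verts G \<subseteq> S}\<rparr>"

definition point_set :: "pgraph \<Rightarrow> complex set" where
  "point_set G = verts G \<union> \<Union> (edges G)"

definition faces :: "pgraph \<Rightarrow> complex set set" where
  "faces G = components (- point_set G)"

section \<open>Paths and cycles\<close>

text \<open>Paths and cycles are given by their lists of vertices; for a cycle the last vertex is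
  adjacent to the first.\<close>

definition is_path :: "pgraph \<Rightarrow> complex list \<Rightarrow> bool" where
  "is_path G p \<longleftrightarrow> p \<noteq> [] \<and> set p \<subseteq> verts G \<and> distinct p \<and> successively (adj G) p"

definition is_cycle :: "pgraph \<Rightarrow> complex list \<Rightarrow> bool" where
  "is_cycle G C \<longleftrightarrow>
     3 \<le> length C \<and> distinct C \<and> successively (adj G) C \<and> adj G (last C) (hd C)"

definition cycle_graph :: "pgraph \<Rightarrow> complex list \<Rightarrow> pgraph" where
  "cycle_graph G C =
     \<lparr>verts = set C,
      edges = {e \<in> edges G. \<exists>i<length C. joins e (C ! i) (C ! (Suc i mod length C))}\<rparr>"

definition cycle_curve :: "pgraph \<Rightarrow> complex list \<Rightarrow> complex set" where
  "cycle_curve G C = point_set (cycle_graph G C)"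

definition bounded_by :: "pgraph \<Rightarrow> complex set \<Rightarrow> complex list \<Rightarrow> bool" where
  "bounded_by G F C \<longleftrightarrow> is_cycle G C \<and> frontier F = cycle_curve G C"

section \<open>Maximal and semi-maximal planar graphs\<close>

definition planar :: "complex set \<Rightarrow> (complex \<Rightarrow> complex \<Rightarrow> bool) \<Rightarrow> bool" where
  "planar V A \<longleftrightarrow>
     (\<exists>H \<phi>. plane_graph H \<and> bij_betw \<phi> V (verts H) \<and>
        (\<forall>u\<in>V. \<forall>v\<in>V. A u v \<longleftrightarrow> adj H (\<phi> u) (\<phi> v)))"

text \<open>The graph itself is drawn, but the graphs with an added edge may be redrawn arbitrarily.\<close>

definition maximal_planar :: "pgraph \<Rightarrow> bool" where
  "maximal_planar G \<longleftrightarrow>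
     plane_graph G \<and>
     (\<forall>u\<in>verts G. \<forall>v\<in>verts G. u \<noteq> v \<and> \<not> adj G u v \<longrightarrow>
        \<not> planar (verts G) (\<lambda>x y. adj G x y \<or> {x, y} = {u, v}))"

text \<open>One face \<open>F\<close> is bounded by the cycle \<open>C\<close>, all others are triangles.\<close>

definition semi_maximal_at :: "pgraph \<Rightarrow> complex list \<Rightarrow> complex set \<Rightarrow> bool" where
  "semi_maximal_at G C F \<longleftrightarrow>
     plane_graph G \<and> 4 \<le> length C \<and> F \<in> faces G \<and> bounded_by G F C \<and>
     (\<forall>F'\<in>faces G - {F}. \<exists>T. length T = 3 \<and> bounded_by G F' T)"

definition SMPG :: "pgraph \<Rightarrow> complex list \<Rightarrow> bool" where
  "SMPG G C \<longleftrightarrow> (\<exists>F. \<not> bounded F \<and> semi_maximal_at G C F)"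

text \<open>A semi-maximal planar graph drawn in the exterior of \<open>C\<close>: on the sphere its exceptional face
  is now the one inside \<open>C\<close>, whereas its unbounded face is a triangle.\<close>

definition exterior_SMPG :: "pgraph \<Rightarrow> complex list \<Rightarrow> bool" where
  "exterior_SMPG G C \<longleftrightarrow> semi_maximal_at G C (inside (cycle_curve G C))"

section \<open>Colourings and Kempe classes\<close>

definition chromatic_number :: "pgraph \<Rightarrow> nat" where
  "chromatic_number G =
     (LEAST k. \<exists>c :: complex \<Rightarrow> nat. c ` verts G \<subseteq> {..<k} \<and> (\<forall>u v. adj G u v \<longrightarrow> c u \<noteq> c v))"

definition colourings :: "pgraph \<Rightarrow> (complex \<Rightarrow> nat) set" where
  "colourings G = {f \<in> verts G \<rightarrow>\<^sub>E {1, 2, 3, 4}. \<forall>u v. adj G u v \<longrightarrow> f u \<noteq> f v}"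

definition renaming :: "pgraph \<Rightarrow> ((complex \<Rightarrow> nat) \<times> (complex \<Rightarrow> nat)) set" where
  "renaming G = {(f, g). f \<in> colourings G \<and> g \<in> colourings G \<and>
     (\<exists>\<pi>. \<pi> permutes {1, 2, 3, 4} \<and> (\<forall>v\<in>verts G. g v = \<pi> (f v)))}"

lemma equiv_renaming: "equiv (colourings G) (renaming G)"
proof (rule equivI)
  show "renaming G \<subseteq> colourings G \<times> colourings G"
    by (auto simp: renaming_def)
  show "refl_on (colourings G) (renaming G)"
    by (auto simp: refl_on_def renaming_def intro!: exI[of _ id] permutes_id)
  show "sym (renaming G)"
  proof (rule symI)
    fix f g assume "(f, g) \<in> renaming G"
    then obtain \<pi> where "f \<in> colourings G" "g \<in> colourings G"
      and \<pi>: "\<pi> permutes {1, 2, 3, 4}" "\<forall>v\<in>verts G. g v = \<pi> (f v)"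
      by (auto simp: renaming_def)
    moreover have "\<forall>v\<in>verts G. f v = inv \<pi> (g v)"
      using \<pi> by (simp add: permutes_inverses)
    ultimately show "(g, f) \<in> renaming G"
      using permutes_inv[OF \<pi>(1)] by (auto simp: renaming_def)
  qed
  show "trans (renaming G)"
  proof (rule transI)
    fix f g h assume "(f, g) \<in> renaming G" "(g, h) \<in> renaming G"
    then obtain \<pi> \<rho> where *: "f \<in> colourings G" "h \<in> colourings G"
      and \<pi>: "\<pi> permutes {1, 2, 3, 4}" "\<forall>v\<in>verts G. g v = \<pi> (f v)"
      and \<rho>: "\<rho> permutes {1, 2, 3, 4}" "\<forall>v\<in>verts G. h v = \<rho> (g v)"
      by (auto simp: renaming_def)
    have "\<forall>v\<in>verts G. h v = (\<rho> \<circ> \<pi>) (f v)" using \<pi> \<rho> by simp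
    with * permutes_compose[OF \<pi>(1) \<rho>(1)] show "(f, h) \<in> renaming G"
      unfolding renaming_def by blast
  qed
qed

definition C40 :: "pgraph \<Rightarrow> (complex \<Rightarrow> nat) set set" where
  "C40 G = colourings G // renaming G"

definition bichromatic_cycle :: "pgraph \<Rightarrow> (complex \<Rightarrow> nat) \<Rightarrow> complex list \<Rightarrow> bool" where
  "bichromatic_cycle G f C \<longleftrightarrow> is_cycle G C \<and> card (f ` set C) = 2"

definition swap_inside ::
  "pgraph \<Rightarrow> complex list \<Rightarrow> nat \<Rightarrow> nat \<Rightarrow> (complex \<Rightarrow> nat) \<Rightarrow> complex \<Rightarrow> nat" where
  "swap_inside G C s t f =
     (\<lambda>v\<in>verts G. if v \<in> inside (cycle_curve G C) then Transposition.transpose s t (f v) else f v)"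

text \<open>The \<open>\<sigma>\<close>-operations, acting on colourings up to renaming of the colours.\<close>

definition kempe_step :: "pgraph \<Rightarrow> ((complex \<Rightarrow> nat) set \<times> (complex \<Rightarrow> nat) set) set" where
  "kempe_step G =
     {(renaming G `` {f}, renaming G `` {swap_inside G C s t f}) | f C s t.
        f \<in> colourings G \<and> bichromatic_cycle G f C \<and>
        s \<noteq> t \<and> {1, 2, 3, 4} - f ` set C = {s, t}}"

definition kempe_class :: "pgraph \<Rightarrow> (complex \<Rightarrow> nat) \<Rightarrow> (complex \<Rightarrow> nat) set set" where
  "kempe_class G f = (kempe_step G \<union> (kempe_step G)\<inverse>)\<^sup>* `` {renaming G `` {f}}"

definition UB_cycle :: "pgraph \<Rightarrow> (complex \<Rightarrow> nat) \<Rightarrow> complex list \<Rightarrow> bool" where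
  "UB_cycle G f C \<longleftrightarrow>
     bichromatic_cycle G f C \<and> (\<forall>K\<in>kempe_class G f. \<forall>f'\<in>K. card (f' ` set C) = 2)"

definition UBC_colouring :: "pgraph \<Rightarrow> complex list \<Rightarrow> (complex \<Rightarrow> nat) \<Rightarrow> bool" where
  "UBC_colouring G C f \<longleftrightarrow>
     maximal_planar G \<and> chromatic_number G = 4 \<and> (\<forall>v\<in>verts G. 4 \<le> deg G v) \<and>
     f \<in> colourings G \<and> UB_cycle G f C"

section \<open>Base modules\<close>

definition exterior_complement :: "pgraph \<Rightarrow> complex list \<Rightarrow> pgraph \<Rightarrow> bool" where
  "exterior_complement M C G\<^sub>1 \<longleftrightarrow>
     exterior_SMPG G\<^sub>1 C \<and> graph_inter M G\<^sub>1 = cycle_graph M C"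

definition base_module4 :: "pgraph \<Rightarrow> complex list \<Rightarrow> bool" where
  "base_module4 M C \<longleftrightarrow>
     SMPG M C \<and> length C = 4 \<and>
     (\<exists>G\<^sub>1 g. exterior_complement M C G\<^sub>1 \<and> UBC_colouring (graph_union M G\<^sub>1) C g)"

definition module_colouring :: "pgraph \<Rightarrow> complex list \<Rightarrow> (complex \<Rightarrow> nat) \<Rightarrow> bool" where
  "module_colouring M C f \<longleftrightarrow>
     (\<exists>G\<^sub>1 g. exterior_complement M C G\<^sub>1 \<and> UBC_colouring (graph_union M G\<^sub>1) C g \<and>
        f = restrict g (verts M))"

definition module_paths ::
  "pgraph \<Rightarrow> (complex \<Rightarrow> nat) \<Rightarrow> nat \<Rightarrow> complex \<Rightarrow> complex \<Rightarrow> complex list set" where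
  "module_paths M f i x y =
     {p. is_path M p \<and> hd p = x \<and> last p = y \<and> f ` set p \<subseteq> {2, i}}"

text \<open>For \<open>p\<close> from \<open>v\<^sub>2\<close> to \<open>v\<^sub>4\<close> and \<open>w\<close> one of \<open>v\<^sub>1\<close>, \<open>v\<^sub>3\<close>, the list \<open>w # p\<close> is the cycle formed
  by \<open>v\<^sub>4 w v\<^sub>2\<close> and \<open>p\<close>.\<close>

definition side_subgraph :: "pgraph \<Rightarrow> complex \<Rightarrow> complex list \<Rightarrow> pgraph" where
  "side_subgraph M w p =
     induced_subgraph M (set (w # p) \<union> inside (cycle_curve M (w # p)))"

definition parallel ::
  "pgraph \<Rightarrow> complex \<Rightarrow> complex \<Rightarrow> complex \<Rightarrow> complex \<Rightarrow> complex list \<Rightarrow> complex list \<Rightarrow> bool" where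
  "parallel M v\<^sub>1 v\<^sub>2 v\<^sub>3 v\<^sub>4 p q \<longleftrightarrow>
     (let H\<^sub>1 = verts (side_subgraph M v\<^sub>1 p);
          H\<^sub>2 = verts (side_subgraph M v\<^sub>3 p);
          Q = set q - {v\<^sub>2, v\<^sub>4}
      in (H\<^sub>1 \<inter> Q = {} \<and> H\<^sub>2 \<inter> Q \<noteq> {} \<and> set q \<subseteq> H\<^sub>2) \<or>
         (H\<^sub>2 \<inter> Q = {} \<and> H\<^sub>1 \<inter> Q \<noteq> {} \<and> set q \<subseteq> H\<^sub>1))"

end

theory Submission imports Defs begin

text \<open>This is the case of Kempe's argument for a vertex of degree five in which his two simultaneous
  interchanges are legitimate.  By the theta-curve theorem, the paths from \<open>v\<^sub>2\<close> to \<open>v\<^sub>4\<close>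
  coloured \<open>2, 3\<close> and \<open>2, 4\<close> both separate \<open>v\<^sub>1\<close> from \<open>v\<^sub>3\<close>.  As they are parallel, one may
  assume that the second runs on the \<open>v\<^sub>3\<close> side of the first.  Interchange 1 and 4 on the whole \<open>v\<^sub>1\<close>
  side of the first path, then 1 and 3 on the whole \<open>v\<^sub>3\<close> side of the second; both colourings stay
  proper, since the separating path carries neither of the interchanged colours.  As \<open>v\<^sub>2\<close> has
  degree 4, its neighbours are \<open>v\<^sub>1\<close>, \<open>v\<^sub>3\<close> and its successors on the two paths; none of
  them is coloured 1 any more, so \<open>v\<^sub>2\<close> can be recoloured with 1 while \<open>v\<^sub>4\<close> keeps 2.\<close>

section \<open>Arcs and Jordan curves\<close>

lemma joins_commute: "joins e u v \<longleftrightarrow> joins e v u"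
  unfolding joins_def by (metis arc_reversepath path_image_reversepath pathstart_reversepath
      pathfinish_reversepath)

lemma joins_imp_distinct: "joins e u v \<Longrightarrow> u \<noteq> v"
  unfolding joins_def by (metis arc_distinct_ends)

lemma joins_endpoints: "joins e u v \<Longrightarrow> u \<in> e \<and> v \<in> e"
  unfolding joins_def by (metis pathstart_in_path_image pathfinish_in_path_image)

lemma joins_connected: "joins e u v \<Longrightarrow> connected e"
  unfolding joins_def by (metis connected_arc_image)

lemma joins_closed: "joins e u v \<Longrightarrow> closed e"
  unfolding joins_def by (metis closed_arc_image)

lemma joins_interior_connected: "joins e u v \<Longrightarrow> connected (e - {u, v})"
  unfolding joins_def by (metis arc_imp_simple_path connected_simple_path_endless)

text \<open>A connected set with two points has no isolated point, and deleting finitely many points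
  keeps every limit point. This later carries the position of an open edge over to its ends.\<close>

lemma joins_endpoint_closure:
  assumes "joins e u v"
  shows "u \<in> closure (e - {u, v})"
proof -
  have "u islimpt e"
    using joins_connected[OF assms] joins_endpoints[OF assms] joins_imp_distinct[OF assms]
    by (intro connected_imp_perfect) auto
  then have "u islimpt (insert u (insert v (e - {u, v})))"
    by (rule islimpt_subset) blast
  then have "u islimpt (e - {u, v})"
    by (simp add: islimpt_insert)
  then show ?thesis
    by (simp add: closure_def)
qed

lemma joins_Un_simple_closed:
  assumes "joins A a b" "joins B a b" "A \<inter> B = {a, b}"
  obtains c where "simple_path c" "pathfinish c = pathstart c" "path_image c = A \<union> B"
proof -
  obtain g where g: "arc g" "path_image g = A" "pathstart g = a" "pathfinish g = b"
    using assms(1) unfolding joins_def by blast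
  obtain h where h: "arc h" "path_image h = B" "pathstart h = b" "pathfinish h = a"
    using assms(2) unfolding joins_commute[of B a b] unfolding joins_def by blast
  show ?thesis
  proof (rule that[of "g +++ h"])
    show "simple_path (g +++ h)"
      using g h assms(3) by (intro simple_path_join_loop) auto
  qed (use g h in \<open>auto simp: path_image_join\<close>)
qed

text \<open>The splitting theorem for the inside of a simple closed curve, put in terms of
  \<open>joins\<close>. That \<open>L\<close> meets the inside of \<open>A \<union> B\<close>
  singles out \<open>L\<close> as the middle one of the three arcs.\<close>

lemma theta_curve:
  assumes "joins A a b" "joins B a b" "joins L a b"
    and "A \<inter> B = {a, b}" "A \<inter> L = {a, b}" "B \<inter> L = {a, b}"
    and "L \<inter> inside (A \<union> B) \<noteq> {}"
  shows "inside (A \<union> L) \<inter> inside (B \<union> L) = {}"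
    and "inside (A \<union> L) \<union> inside (B \<union> L) \<union> (L - {a, b}) = inside (A \<union> B)"
proof -
  obtain c1 where 1: "arc c1" "path_image c1 = A" "pathstart c1 = a" "pathfinish c1 = b"
    using assms(1) unfolding joins_def by blast
  obtain c2 where 2: "arc c2" "path_image c2 = B" "pathstart c2 = a" "pathfinish c2 = b"
    using assms(2) unfolding joins_def by blast
  obtain c where 3: "arc c" "path_image c = L" "pathstart c = a" "pathfinish c = b"
    using assms(3) unfolding joins_def by blast
  have "inside (A \<union> L) \<inter> inside (B \<union> L) = {} \<and>
      inside (A \<union> L) \<union> inside (B \<union> L) \<union> (L - {a, b}) = inside (A \<union> B)"
    using split_inside_simple_closed_curve[of c1 a b c2 c]
      1 2 3 assms(4-7) joins_imp_distinct[OF assms(1)]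
    by (auto simp: arc_imp_simple_path)
  then show "inside (A \<union> L) \<inter> inside (B \<union> L) = {}"
    and "inside (A \<union> L) \<union> inside (B \<union> L) \<union> (L - {a, b}) = inside (A \<union> B)"
    by auto
qed

section \<open>Inside and outside of closed curves\<close>

lemma connected_subset_inside:
  assumes "connected X" "X \<inter> S = {}" "X \<inter> inside S \<noteq> {}"
  shows "X \<subseteq> inside S"
proof -
  obtain x where x: "x \<in> X" "x \<in> inside S" using assms(3) by blast
  have "connected_component (- S) x y" if "y \<in> X" for y
    unfolding connected_component_def using assms(1,2) x(1) that by (intro exI[of _ X]) auto
  with x(2) show ?thesis
    using inside_same_component by blast
qed

text \<open>A Jordan curve is the frontier of its outside, so if the open set
  \<open>inside J\<close> met it, it would meet that outside too. The outside is connected and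
  avoids \<open>J\<close>, so it would lie in one bounded component of the complement of
  \<open>J\<close>; but it is unbounded.\<close>

lemma nested_Jordan_curve:
  fixes c :: "real \<Rightarrow> complex"
  assumes "simple_path c" "pathfinish c = pathstart c" "closed J"
    and "J \<subseteq> path_image c \<union> inside (path_image c)"
  shows "inside J \<inter> path_image c = {}"
proof (rule ccontr)
  let ?S = "path_image c"
  note jordan = Jordan_inside_outside[OF assms(1,2)]
  assume "inside J \<inter> ?S \<noteq> {}"
  then obtain x where x: "x \<in> inside J" "x \<in> frontier (outside ?S)"
    using jordan by blast
  have "open (inside J)" using assms(3) by (rule open_inside)
  then have "inside J \<inter> outside ?S \<noteq> {}"
    using x open_Int_closure_eq_empty[of "inside J" "outside ?S"] by (auto simp: frontier_def)
  moreover have "outside ?S \<inter> J = {}"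
    using assms(4) by (auto simp: union_with_inside)
  ultimately have "outside ?S \<subseteq> inside J"
    using jordan by (intro connected_subset_inside) auto
  moreover obtain z where "z \<in> outside ?S" using jordan by blast
  ultimately have "outside ?S \<subseteq> connected_component_set (- J) z"
    and "bounded (connected_component_set (- J) z)"
    using jordan \<open>outside ?S \<inter> J = {}\<close> connected_component_maximal[of z "outside ?S" "- J"]
    by (auto simp: inside_def)
  then show False using jordan bounded_subset by blast
qed

text \<open>Being connected, unbounded and off the curve, \<open>F\<close> lies in the outside. If
  it were a proper part, the connected outside would meet the frontier of \<open>F\<close>, which is
  the curve itself.\<close>

lemma unbounded_component_eq_outside:
  fixes c :: "real \<Rightarrow> complex"
  assumes "simple_path c" "pathfinish c = pathstart c" "path_image c \<subseteq> S"
    and "open F" "F \<in> components (- S)" "\<not> bounded F" "frontier F = path_image c"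
  shows "F = outside (path_image c)"
proof -
  let ?C = "path_image c"
  note jordan = Jordan_inside_outside[OF assms(1,2)]
  have con: "connected F" "F \<noteq> {}" "F \<subseteq> - S"
    using assms(5) by (auto dest: in_components_connected in_components_nonempty in_components_subset)
  have "\<not> F \<subseteq> inside ?C"
    using assms(6) jordan bounded_subset by blast
  then have "F \<inter> inside ?C = {}"
    using connected_subset_inside[of F ?C] con assms(3) by blast
  then have sub: "F \<subseteq> outside ?C"
    using con(3) assms(3) inside_Un_outside[of ?C] by blast
  show ?thesis
  proof (rule ccontr)
    assume "F \<noteq> outside ?C"
    then have "outside ?C \<inter> frontier F \<noteq> {}"
      using jordan sub con by (intro connected_Int_frontier) auto
    then show False
      using assms(7) by (metis outside_no_overlap Int_commute)
  qed
qed

section \<open>Walks as point sets\<close>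

text \<open>A union takes the place of a choice: in a plane graph exactly one edge joins two
  adjacent vertices, and the union is that edge.\<close>

definition edge_arc :: "pgraph \<Rightarrow> complex \<Rightarrow> complex \<Rightarrow> complex set" where
  "edge_arc G u v = \<Union> {e \<in> edges G. joins e u v}"

fun walk_pts :: "pgraph \<Rightarrow> complex list \<Rightarrow> complex set" where
  "walk_pts G [] = {}"
| "walk_pts G [u] = {u}"
| "walk_pts G (u # v # p) = insert u (edge_arc G u v \<union> walk_pts G (v # p))"

lemma edge_arc_commute: "edge_arc G u v = edge_arc G v u"
  unfolding edge_arc_def by (metis joins_commute)

lemma adj_commute: "adj G u v \<longleftrightarrow> adj G v u"
  unfolding adj_def by (metis joins_commute)

lemma adj_irrefl: "\<not> adj G u u"
  unfolding adj_def by (metis joins_imp_distinct)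

section \<open>Edges of a plane graph and the arcs traced by paths\<close>

lemma plane_edge_ends:
  "plane_graph G \<Longrightarrow> e \<in> edges G \<Longrightarrow> \<exists>u v. joins e u v \<and> e \<inter> verts G = {u, v}"
  by (simp add: plane_graph_def)

lemma plane_edge_eqI:
  "plane_graph G \<Longrightarrow> e \<in> edges G \<Longrightarrow> e' \<in> edges G \<Longrightarrow> e \<inter> verts G = e' \<inter> verts G \<Longrightarrow> e = e'"
  unfolding plane_graph_def by metis

lemma plane_edges_meet:
  "plane_graph G \<Longrightarrow> e \<in> edges G \<Longrightarrow> e' \<in> edges G \<Longrightarrow> e \<noteq> e' \<Longrightarrow> e \<inter> e' \<subseteq> verts G"
  by (simp add: plane_graph_def)

text \<open>\<open>plane_graph\<close> provides some pair of ends only. The distinct vertices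
  \<open>u\<close> and \<open>v\<close> lie on \<open>e\<close>, so they exhaust that pair.\<close>

lemma plane_edge_inter:
  assumes "plane_graph G" "e \<in> edges G" "joins e u v" "u \<in> verts G" "v \<in> verts G"
  shows "e \<inter> verts G = {u, v}"
proof -
  obtain a b where ab: "e \<inter> verts G = {a, b}"
    using plane_edge_ends[OF assms(1,2)] by blast
  have "u \<in> e \<inter> verts G" "v \<in> e \<inter> verts G"
    using joins_endpoints[OF assms(3)] assms(4,5) by auto
  then show ?thesis
    unfolding ab using joins_imp_distinct[OF assms(3)] by auto
qed

lemma plane_edge_unique:
  assumes "plane_graph G" "e \<in> edges G" "joins e u v" "e' \<in> edges G" "joins e' u v"
    and "u \<in> verts G" "v \<in> verts G"
  shows "e = e'"
proof -
  have "e \<inter> verts G = e' \<inter> verts G"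
    using plane_edge_inter[OF assms(1)] assms by metis
  then show ?thesis using plane_edge_eqI[OF assms(1,2,4)] by blast
qed

lemma edge_arc:
  assumes "plane_graph G" "adj G u v"
  shows "edge_arc G u v \<in> edges G" "joins (edge_arc G u v) u v"
    "edge_arc G u v \<inter> verts G = {u, v}"
proof -
  obtain e where e: "e \<in> edges G" "joins e u v" "u \<in> verts G" "v \<in> verts G"
    using assms(2) unfolding adj_def by blast
  then have "{e \<in> edges G. joins e u v} = {e}"
    using plane_edge_unique[OF assms(1)] by blast
  then have "edge_arc G u v = e" by (simp add: edge_arc_def)
  then show "edge_arc G u v \<in> edges G" "joins (edge_arc G u v) u v"
    "edge_arc G u v \<inter> verts G = {u, v}"
    using e plane_edge_inter[OF assms(1)] by auto
qed

lemma set_subset_walk_pts: "set p \<subseteq> walk_pts G p"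
  by (induction G p rule: walk_pts.induct) auto

lemma walk_pts_subset_point_set: "set p \<subseteq> verts G \<Longrightarrow> walk_pts G p \<subseteq> point_set G"
  by (induction G p rule: walk_pts.induct) (auto simp: point_set_def edge_arc_def)

lemma walk_pts_cases:
  assumes "z \<in> walk_pts G p" "successively (adj G) p"
  shows "z \<in> set p \<or> (\<exists>u\<in>set p. \<exists>v\<in>set p. adj G u v \<and> z \<in> edge_arc G u v)"
  using assms by (induction G p rule: walk_pts.induct) auto

lemma walk_pts_Int_verts:
  assumes "plane_graph G" "successively (adj G) p" "set p \<subseteq> verts G"
  shows "walk_pts G p \<inter> verts G = set p"
proof (intro equalityI subsetI)
  fix z assume z: "z \<in> walk_pts G p \<inter> verts G"
  then consider "z \<in> set p" | u v where "u \<in> set p" "v \<in> set p" "adj G u v" "z \<in> edge_arc G u v"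
    using walk_pts_cases[OF _ assms(2), of z] by blast
  then show "z \<in> set p"
  proof cases
    case 2
    then have "z \<in> {u, v}" using z edge_arc(3)[OF assms(1) 2(3)] by blast
    with 2 show ?thesis by blast
  qed
qed (use set_subset_walk_pts[of p G] assms(3) in blast)

text \<open>A common point that is no vertex lies on an edge of each walk. Distinct edges meet only
  in vertices, so this is one edge, and its ends would be adjacent common vertices.\<close>

lemma walk_pts_Int:
  assumes "plane_graph G" "successively (adj G) p" "successively (adj G) q"
    and "set p \<subseteq> verts G" "set q \<subseteq> verts G"
    and "\<And>u v. \<lbrakk>u \<in> set p \<inter> set q; v \<in> set p \<inter> set q\<rbrakk> \<Longrightarrow> \<not> adj G u v"
  shows "walk_pts G p \<inter> walk_pts G q = set p \<inter> set q"
proof (intro equalityI subsetI)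
  fix z assume z: "z \<in> walk_pts G p \<inter> walk_pts G q"
  show "z \<in> set p \<inter> set q"
  proof (cases "z \<in> verts G")
    case True
    then have "z \<in> walk_pts G p \<inter> verts G" "z \<in> walk_pts G q \<inter> verts G" using z by auto
    then show ?thesis
      unfolding walk_pts_Int_verts[OF assms(1,2,4)] walk_pts_Int_verts[OF assms(1,3,5)] by blast
  next
    case False
    then obtain u v where uv: "u \<in> set p" "v \<in> set p" "adj G u v" "z \<in> edge_arc G u v"
      using z walk_pts_cases[OF _ assms(2), of z] assms(4) by blast
    obtain s t where st: "s \<in> set q" "t \<in> set q" "adj G s t" "z \<in> edge_arc G s t"
      using z False walk_pts_cases[OF _ assms(3), of z] assms(5) by blast
    have "edge_arc G u v = edge_arc G s t"
      using plane_edges_meet[OF assms(1) edge_arc(1)[OF assms(1) uv(3)] edge_arc(1)[OF assms(1) st(3)]]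
        False uv(4) st(4) by blast
    then have "{u, v} = {s, t}"
      using edge_arc(3)[OF assms(1) uv(3)] edge_arc(3)[OF assms(1) st(3)] by simp
    then have "u \<in> set q" "v \<in> set q" using st by auto
    then show ?thesis using assms(6) uv by blast
  qed
qed (use set_subset_walk_pts[of p G] set_subset_walk_pts[of q G] in blast)

lemma joins_walk_pts:
  assumes "plane_graph G" "is_path G p" "2 \<le> length p"
  shows "joins (walk_pts G p) (hd p) (last p)"
  using assms
proof (induction G p rule: walk_pts.induct)
  case (3 G u v p)
  then have uv: "adj G u v" and path: "is_path G (v # p)"
    by (auto simp: is_path_def)
  note e = edge_arc[OF 3(2) uv]
  have ends: "u \<in> edge_arc G u v" "v \<in> edge_arc G u v" using joins_endpoints[OF e(2)] by auto
  show ?case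
  proof (cases "p = []")
    case True
    then show ?thesis using e ends by (simp add: insert_absorb)
  next
    case False
    then have "2 \<le> length (v # p)" by (cases p) auto
    then have "joins (walk_pts G (v # p)) v (last (v # p))"
      using "3.IH"[OF 3(2) path] by simp
    then obtain h where h: "arc h" "path_image h = walk_pts G (v # p)" "pathstart h = v"
      "pathfinish h = last (v # p)" unfolding joins_def by blast
    obtain g where g: "arc g" "path_image g = edge_arc G u v" "pathstart g = u" "pathfinish g = v"
      using e(2) unfolding joins_def by blast
    \<comment> \<open>The first edge is read as a walk on two vertices. It shares only
      \<open>v\<close> with the rest, as \<open>u\<close> does not recur, so there are no adjacent
      common vertices.\<close>
    have "walk_pts G [u, v] \<inter> walk_pts G (v # p) = set [u, v] \<inter> set (v # p)"
      using 3 uv path adj_irrefl by (intro walk_pts_Int) (auto simp: is_path_def)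
    moreover have "walk_pts G [u, v] = edge_arc G u v"
      using ends by auto
    ultimately have "edge_arc G u v \<inter> walk_pts G (v # p) = {v}"
      using 3 by (auto simp: is_path_def)
    then have "arc (g +++ h)"
      using g h by (intro arc_join) auto
    moreover have "path_image (g +++ h) = walk_pts G (u # v # p)"
      using g h ends by (auto simp: path_image_join)
    ultimately show ?thesis
      unfolding joins_def using g h by (intro exI[of _ "g +++ h"]) auto
  qed
qed auto

lemma walk_pts_conv_nth:
  "walk_pts G p = set p \<union> (\<Union>i\<in>{i. Suc i < length p}. edge_arc G (p ! i) (p ! Suc i))"
proof (induction G p rule: walk_pts.induct)
  case (3 G u v p)
  have "{i. Suc i < length (u # v # p)} = insert 0 (Suc ` {i. Suc i < length (v # p)})"
    by (auto simp: image_iff gr0_conv_Suc less_Suc_eq_0_disj)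
  then show ?case using 3 by auto
qed auto

lemma walk_pts_snoc:
  "p \<noteq> [] \<Longrightarrow> walk_pts G (p @ [x]) = insert x (walk_pts G p \<union> edge_arc G (last p) x)"
  by (induction G p rule: walk_pts.induct) auto

text \<open>Repeating the head at the end turns the closing edge, reached by the index modulo the
  length, into an ordinary step of the walk.\<close>

lemma cycle_curve_eq_walk_pts:
  assumes "C \<noteq> []"
  shows "cycle_curve G C = walk_pts G (C @ [hd C])"
proof -
  have "edge_arc G ((C @ [hd C]) ! i) ((C @ [hd C]) ! Suc i) =
      edge_arc G (C ! i) (C ! (Suc i mod length C))" if "i < length C" for i
    using that assms by (auto simp: nth_append hd_conv_nth mod_Suc)
  moreover have "cycle_curve G C =
      set C \<union> (\<Union>i\<in>{i. i < length C}. edge_arc G (C ! i) (C ! (Suc i mod length C)))"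
    by (auto simp: cycle_curve_def point_set_def cycle_graph_def edge_arc_def)
  ultimately show ?thesis
    using assms by (auto simp: walk_pts_conv_nth)
qed

text \<open>Cuts the closed curve at the ends of \<open>p\<close> into two arcs, the form in which
  \<open>theta_curve\<close> applies.\<close>

lemma cycle_curve_Cons:
  assumes "p \<noteq> []"
  shows "cycle_curve G (w # p) = walk_pts G [hd p, w, last p] \<union> walk_pts G p"
proof -
  obtain u q where p: "p = u # q" using assms by (cases p) auto
  have "last p \<in> walk_pts G p" "u \<in> walk_pts G p"
    using set_subset_walk_pts[of p G] p by auto
  moreover have "walk_pts G ((w # p) @ [w]) = insert w (edge_arc G w u \<union> walk_pts G (p @ [w]))"
    by (simp add: p)
  ultimately show ?thesis
    using assms p walk_pts_snoc[of p G w] cycle_curve_eq_walk_pts[of "w # p" G]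
      edge_arc_commute[of G w] by auto
qed

section \<open>Recolouring\<close>

text \<open>Edges within \<open>S\<close> or within its complement stay proper as a transposition is
  injective. On an edge leaving \<open>S\<close> the outer end has neither colour, so the
  interchange cannot create a clash there. In effect \<open>S\<close> contains only whole Kempe
  chains in \<open>s\<close>, \<open>t\<close>.\<close>

lemma colourings_swap:
  assumes "f \<in> colourings G" "s \<in> {1, 2, 3, 4}" "t \<in> {1, 2, 3, 4}" "S \<subseteq> verts G"
    and "\<And>u v. \<lbrakk>adj G u v; u \<in> S; v \<notin> S\<rbrakk> \<Longrightarrow> f v \<noteq> s \<and> f v \<noteq> t"
  shows "(\<lambda>v. if v \<in> S then Transposition.transpose s t (f v) else f v) \<in> colourings G"
proof -
  let ?g = "\<lambda>v. if v \<in> S then Transposition.transpose s t (f v) else f v"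
  have f: "f \<in> verts G \<rightarrow>\<^sub>E {1, 2, 3, 4}" and proper: "\<And>u v. adj G u v \<Longrightarrow> f u \<noteq> f v"
    using assms(1) by (auto simp: colourings_def)
  have "?g \<in> verts G \<rightarrow>\<^sub>E {1, 2, 3, 4}"
  proof (rule PiE_I)
    show "?g v \<in> {1, 2, 3, 4}" if "v \<in> verts G" for v
      using PiE_mem[OF f that] assms(2,3) unfolding Transposition.transpose_def by presburger
    \<comment> \<open>Colourings are extensional; since \<open>S\<close> contains only vertices, the
      default value is never transposed.\<close>
    show "?g v = undefined" if "v \<notin> verts G" for v
      using PiE_arb[OF f that] assms(4) that by auto
  qed
  moreover have "?g u \<noteq> ?g v" if "adj G u v" for u v
  proof -
    have "adj G v u" using that adj_commute by blast
    then show ?thesis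
      using proper[OF that] assms(5)[OF that] assms(5)[of v u]
      by (cases "u \<in> S"; cases "v \<in> S") (auto simp: Transposition.transpose_def split: if_splits)
  qed
  ultimately show ?thesis by (auto simp: colourings_def)
qed

text \<open>Renamings are injective, so whether two vertices differ in colour is the same for every
  representative of a class.\<close>

lemma C40_separates:
  assumes "k \<in> colourings G" "u \<in> verts G" "v \<in> verts G" "k u \<noteq> k v"
  shows "\<exists>K\<in>C40 G. \<forall>f'\<in>K. f' u \<noteq> f' v"
proof (rule bexI[of _ "renaming G `` {k}"])
  show "renaming G `` {k} \<in> C40 G"
    using assms(1) by (auto simp: C40_def quotient_def)
  show "\<forall>f'\<in>renaming G `` {k}. f' u \<noteq> f' v"
    using assms by (auto simp: renaming_def permutes_inj[THEN inj_eq])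
qed

section \<open>The two sides of a path across a quadrangle\<close>

text \<open>The semi-maximal graph without reference to faces: \<open>encloses\<close> says that
  nothing is drawn outside the 4-cycle, which is already cut into its two arcs from
  \<open>v\<^sub>2\<close> to \<open>v\<^sub>4\<close>.\<close>

locale quadrangle =
  fixes M :: pgraph and v\<^sub>1 v\<^sub>2 v\<^sub>3 v\<^sub>4 :: complex
  assumes plane: "plane_graph M"
    and distinct: "distinct [v\<^sub>1, v\<^sub>2, v\<^sub>3, v\<^sub>4]"
    and adjs: "adj M v\<^sub>1 v\<^sub>2" "adj M v\<^sub>2 v\<^sub>3" "adj M v\<^sub>3 v\<^sub>4" "adj M v\<^sub>4 v\<^sub>1"
    and nonadj: "\<not> adj M v\<^sub>2 v\<^sub>4"
    and encloses: "point_set M \<inter> outside (walk_pts M [v\<^sub>2, v\<^sub>1, v\<^sub>4] \<union> walk_pts M [v\<^sub>2, v\<^sub>3, v\<^sub>4]) = {}"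
begin

text \<open>The symmetry that reduces the two alternatives of \<open>parallel\<close> to
  one.\<close>

lemma swapped: "quadrangle M v\<^sub>3 v\<^sub>2 v\<^sub>1 v\<^sub>4"
proof
  show "distinct [v\<^sub>3, v\<^sub>2, v\<^sub>1, v\<^sub>4]" using distinct by auto
  show "adj M v\<^sub>3 v\<^sub>2" "adj M v\<^sub>2 v\<^sub>1" "adj M v\<^sub>1 v\<^sub>4" "adj M v\<^sub>4 v\<^sub>3"
    using adjs by (simp_all only: adj_commute)
  show "point_set M \<inter> outside (walk_pts M [v\<^sub>2, v\<^sub>3, v\<^sub>4] \<union> walk_pts M [v\<^sub>2, v\<^sub>1, v\<^sub>4]) = {}"
    using encloses by (simp only: Un_commute)
qed (fact plane nonadj)+

lemma corners: "v\<^sub>1 \<in> verts M" "v\<^sub>2 \<in> verts M" "v\<^sub>3 \<in> verts M" "v\<^sub>4 \<in> verts M"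
  using adjs by (auto simp: adj_def)

abbreviation boundary :: "complex set" where
  "boundary \<equiv> walk_pts M [v\<^sub>2, v\<^sub>1, v\<^sub>4] \<union> walk_pts M [v\<^sub>2, v\<^sub>3, v\<^sub>4]"

text \<open>Module-paths are of this kind: \<open>v\<^sub>1\<close> and \<open>v\<^sub>3\<close>
  have colour 1, which does not occur on them.\<close>

definition crossing :: "complex list \<Rightarrow> bool" where
  "crossing l \<longleftrightarrow> is_path M l \<and> hd l = v\<^sub>2 \<and> last l = v\<^sub>4 \<and> v\<^sub>1 \<notin> set l \<and> v\<^sub>3 \<notin> set l"

lemma half_boundary:
  "successively (adj M) [v\<^sub>2, v\<^sub>1, v\<^sub>4]" "successively (adj M) [v\<^sub>2, v\<^sub>3, v\<^sub>4]"
  using adjs adj_commute[of M] by auto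

lemma ends_nonadj: "u \<in> {v\<^sub>2, v\<^sub>4} \<Longrightarrow> v \<in> {v\<^sub>2, v\<^sub>4} \<Longrightarrow> \<not> adj M u v"
  using nonadj adj_commute[of M] adj_irrefl[of M] by auto

text \<open>Unlike \<open>side_subgraph\<close>, this leaves out the path. The corner
  \<open>v\<^sub>1\<close> lies on the bounding curve and so has to be added.\<close>

definition side1 :: "complex list \<Rightarrow> complex set" where
  "side1 l = {v\<^sub>1} \<union> (verts M \<inter> inside (cycle_curve M (v\<^sub>1 # l)))"

definition side3 :: "complex list \<Rightarrow> complex set" where
  "side3 l = {v\<^sub>3} \<union> (verts M \<inter> inside (cycle_curve M (v\<^sub>3 # l)))"

lemma inside_boundary: "z \<in> point_set M \<Longrightarrow> z \<notin> boundary \<Longrightarrow> z \<in> inside boundary"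
  using encloses by (auto simp: inside_outside simp del: walk_pts.simps)

lemma boundary_verts: "boundary \<inter> verts M = {v\<^sub>1, v\<^sub>2, v\<^sub>3, v\<^sub>4}"
proof -
  have "walk_pts M [v\<^sub>2, v\<^sub>1, v\<^sub>4] \<inter> verts M = {v\<^sub>2, v\<^sub>1, v\<^sub>4}"
    "walk_pts M [v\<^sub>2, v\<^sub>3, v\<^sub>4] \<inter> verts M = {v\<^sub>2, v\<^sub>3, v\<^sub>4}"
    using walk_pts_Int_verts[OF plane half_boundary(1)] walk_pts_Int_verts[OF plane half_boundary(2)]
      corners by (auto simp del: walk_pts.simps)
  then show ?thesis by blast
qed

context
  fixes l assumes l: "crossing l"
begin

lemma crossing_path:
  "is_path M l" "l \<noteq> []" "hd l = v\<^sub>2" "last l = v\<^sub>4" "v\<^sub>1 \<notin> set l" "v\<^sub>3 \<notin> set l"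
  "v\<^sub>2 \<in> set l" "v\<^sub>4 \<in> set l" "set l \<subseteq> verts M" "successively (adj M) l"
  using l by (auto simp: crossing_def is_path_def)

text \<open>As \<open>v\<^sub>2\<close> and \<open>v\<^sub>4\<close> are not adjacent, the path has
  an inner vertex. The first one, \<open>z\<close>, serves as a point inside the boundary and as a
  neighbour of \<open>v\<^sub>2\<close>.\<close>

lemma crossing_decompose:
  obtains z r where "l = v\<^sub>2 # z # r" "r \<noteq> []" "adj M v\<^sub>2 z" "z \<in> verts M - {v\<^sub>1, v\<^sub>2, v\<^sub>3, v\<^sub>4}"
proof -
  obtain q where q: "l = v\<^sub>2 # q" using crossing_path by (cases l) auto
  moreover obtain z r where "q = z # r" using crossing_path q distinct by (cases q) auto
  ultimately have "l = v\<^sub>2 # z # r" by simp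
  moreover from this have "adj M v\<^sub>2 z" using crossing_path(10) by simp
  ultimately show ?thesis
    using that crossing_path nonadj
    by (cases "r = []") (auto simp: is_path_def)
qed

lemma crossing_curve:
  "cycle_curve M (v\<^sub>1 # l) = walk_pts M [v\<^sub>2, v\<^sub>1, v\<^sub>4] \<union> walk_pts M l"
  "cycle_curve M (v\<^sub>3 # l) = walk_pts M [v\<^sub>2, v\<^sub>3, v\<^sub>4] \<union> walk_pts M l"
  using cycle_curve_Cons[of l M] crossing_path(2-4) by auto

lemma crossing_joins:
  "joins (walk_pts M l) v\<^sub>2 v\<^sub>4"
  "joins (walk_pts M [v\<^sub>2, v\<^sub>1, v\<^sub>4]) v\<^sub>2 v\<^sub>4" "joins (walk_pts M [v\<^sub>2, v\<^sub>3, v\<^sub>4]) v\<^sub>2 v\<^sub>4"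
proof -
  have "2 \<le> length l" using crossing_decompose by (metis length_Cons le_add2 One_nat_def Suc_1 Suc_le_mono le0)
  then show "joins (walk_pts M l) v\<^sub>2 v\<^sub>4"
    using joins_walk_pts[OF plane, of l] crossing_path by auto
  show "joins (walk_pts M [v\<^sub>2, v\<^sub>1, v\<^sub>4]) v\<^sub>2 v\<^sub>4"
    using joins_walk_pts[OF plane, of "[v\<^sub>2, v\<^sub>1, v\<^sub>4]"] half_boundary corners distinct
    by (auto simp: is_path_def)
  show "joins (walk_pts M [v\<^sub>2, v\<^sub>3, v\<^sub>4]) v\<^sub>2 v\<^sub>4"
    using joins_walk_pts[OF plane, of "[v\<^sub>2, v\<^sub>3, v\<^sub>4]"] half_boundary corners distinct
    by (auto simp: is_path_def)
qed

lemma crossing_Int: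
  "walk_pts M [v\<^sub>2, v\<^sub>1, v\<^sub>4] \<inter> walk_pts M [v\<^sub>2, v\<^sub>3, v\<^sub>4] = {v\<^sub>2, v\<^sub>4}"
  "walk_pts M [v\<^sub>2, v\<^sub>1, v\<^sub>4] \<inter> walk_pts M l = {v\<^sub>2, v\<^sub>4}"
  "walk_pts M [v\<^sub>2, v\<^sub>3, v\<^sub>4] \<inter> walk_pts M l = {v\<^sub>2, v\<^sub>4}"
proof -
  have "set [v\<^sub>2, v\<^sub>1, v\<^sub>4] \<inter> set [v\<^sub>2, v\<^sub>3, v\<^sub>4] = {v\<^sub>2, v\<^sub>4}" "set [v\<^sub>2, v\<^sub>1, v\<^sub>4] \<inter> set l = {v\<^sub>2, v\<^sub>4}"
    "set [v\<^sub>2, v\<^sub>3, v\<^sub>4] \<inter> set l = {v\<^sub>2, v\<^sub>4}"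
    using distinct crossing_path by auto
  then show "walk_pts M [v\<^sub>2, v\<^sub>1, v\<^sub>4] \<inter> walk_pts M [v\<^sub>2, v\<^sub>3, v\<^sub>4] = {v\<^sub>2, v\<^sub>4}"
    "walk_pts M [v\<^sub>2, v\<^sub>1, v\<^sub>4] \<inter> walk_pts M l = {v\<^sub>2, v\<^sub>4}"
    "walk_pts M [v\<^sub>2, v\<^sub>3, v\<^sub>4] \<inter> walk_pts M l = {v\<^sub>2, v\<^sub>4}"
    using walk_pts_Int[OF plane half_boundary(1,2)] walk_pts_Int[OF plane half_boundary(1), of l]
      walk_pts_Int[OF plane half_boundary(2), of l] corners crossing_path(9,10) ends_nonadj
    by (simp_all del: walk_pts.simps)
qed

lemma crossing_theta:
  "inside (cycle_curve M (v\<^sub>1 # l)) \<inter> inside (cycle_curve M (v\<^sub>3 # l)) = {}"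
  "inside (cycle_curve M (v\<^sub>1 # l)) \<union> inside (cycle_curve M (v\<^sub>3 # l)) \<union>
     (walk_pts M l - {v\<^sub>2, v\<^sub>4}) = inside boundary"
proof -
  obtain z r where z: "l = v\<^sub>2 # z # r" "z \<in> verts M - {v\<^sub>1, v\<^sub>2, v\<^sub>3, v\<^sub>4}"
    using crossing_decompose by metis
  \<comment> \<open>The inner vertex \<open>z\<close> shows that the path is the middle arc of the
    theta curve.\<close>
  then have "z \<in> inside boundary"
    using boundary_verts by (intro inside_boundary) (auto simp: point_set_def simp del: walk_pts.simps)
  moreover have "z \<in> walk_pts M l" using set_subset_walk_pts[of l M] z by auto
  ultimately have ne: "walk_pts M l \<inter> inside boundary \<noteq> {}" by blast
  show "inside (cycle_curve M (v\<^sub>1 # l)) \<inter> inside (cycle_curve M (v\<^sub>3 # l)) = {}"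
    "inside (cycle_curve M (v\<^sub>1 # l)) \<union> inside (cycle_curve M (v\<^sub>3 # l)) \<union>
     (walk_pts M l - {v\<^sub>2, v\<^sub>4}) = inside boundary"
    using theta_curve[OF crossing_joins(2,3,1) crossing_Int ne] unfolding crossing_curve .
qed

lemma closed_crossing_curve:
  "closed (cycle_curve M (v\<^sub>1 # l))" "closed (cycle_curve M (v\<^sub>3 # l))"
  unfolding crossing_curve by (intro closed_Un crossing_joins[THEN joins_closed])+

lemma crossing_curve_verts:
  "cycle_curve M (v\<^sub>1 # l) \<inter> verts M = set (v\<^sub>1 # l)"
  "cycle_curve M (v\<^sub>3 # l) \<inter> verts M = set (v\<^sub>3 # l)"
proof -
  have "walk_pts M [v\<^sub>2, v\<^sub>1, v\<^sub>4] \<inter> verts M = {v\<^sub>2, v\<^sub>1, v\<^sub>4}"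
    "walk_pts M [v\<^sub>2, v\<^sub>3, v\<^sub>4] \<inter> verts M = {v\<^sub>2, v\<^sub>3, v\<^sub>4}" "walk_pts M l \<inter> verts M = set l"
    using walk_pts_Int_verts[OF plane half_boundary(1)] walk_pts_Int_verts[OF plane half_boundary(2)]
      walk_pts_Int_verts[OF plane crossing_path(10,9)] corners by (auto simp del: walk_pts.simps)
  then show "cycle_curve M (v\<^sub>1 # l) \<inter> verts M = set (v\<^sub>1 # l)"
    "cycle_curve M (v\<^sub>3 # l) \<inter> verts M = set (v\<^sub>3 # l)"
    using crossing_path(7,8) unfolding crossing_curve by auto
qed

lemma sides_disjoint: "side1 l \<inter> side3 l = {}" "side1 l \<inter> set l = {}" "side3 l \<inter> set l = {}"
proof -
  \<comment> \<open>Both regions lie inside the boundary, on which \<open>v\<^sub>1\<close> and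
    \<open>v\<^sub>3\<close> lie; so neither region contains one of these corners.\<close>
  have "boundary \<inter> inside boundary = {}" by (metis inside_no_overlap Int_commute)
  then have "{v\<^sub>1, v\<^sub>3} \<inter> inside boundary = {}" using boundary_verts by blast
  then have "{v\<^sub>1, v\<^sub>3} \<inter> inside (cycle_curve M (v\<^sub>1 # l)) = {}"
    "{v\<^sub>1, v\<^sub>3} \<inter> inside (cycle_curve M (v\<^sub>3 # l)) = {}"
    using crossing_theta(2) by blast+
  then show "side1 l \<inter> side3 l = {}"
    using crossing_theta(1) distinct unfolding side1_def side3_def by auto
  have "set l \<subseteq> cycle_curve M (v\<^sub>1 # l)" "set l \<subseteq> cycle_curve M (v\<^sub>3 # l)"
    using set_subset_walk_pts[of l M] unfolding crossing_curve by blast+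
  then have "set l \<inter> inside (cycle_curve M (v\<^sub>1 # l)) = {}" "set l \<inter> inside (cycle_curve M (v\<^sub>3 # l)) = {}"
    using inside_no_overlap by blast+
  then show "side1 l \<inter> set l = {}" "side3 l \<inter> set l = {}"
    using crossing_path(5,6) unfolding side1_def side3_def by auto
qed

lemma sides_verts: "side1 l \<subseteq> verts M" "side3 l \<subseteq> verts M"
  using corners by (auto simp: side1_def side3_def)

text \<open>The open edge avoids all three arcs of the theta curve, so it lies in the union of two
  disjoint open regions and, being connected, in one of them. Its ends lie in the closure; an end on
  the bounding curve but off the path can only be the corner.\<close>

lemma edge_on_one_side:
  assumes "adj M a b" "a \<notin> set l" "b \<notin> set l"
  shows "{a, b} \<subseteq> side1 l \<or> {a, b} \<subseteq> side3 l"
proof -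
  note e = edge_arc[OF plane assms(1)]
  let ?e = "edge_arc M a b" and ?J1 = "cycle_curve M (v\<^sub>1 # l)" and ?J3 = "cycle_curve M (v\<^sub>3 # l)"
  have ab: "a \<in> verts M" "b \<in> verts M" using assms(1) by (auto simp: adj_def)
  have eq: "walk_pts M [a, b] = ?e" using joins_endpoints[OF e(2)] by auto
  have succ: "successively (adj M) [a, b]" using assms(1) by simp
  have small: "walk_pts M [a, b] \<inter> walk_pts M q \<subseteq> {a, b}"
    if "successively (adj M) q" "set q \<subseteq> verts M" "\<not> {a, b} \<subseteq> set q" for q
  proof -
    have "\<not> adj M u v" if "u \<in> set [a, b] \<inter> set q" "v \<in> set [a, b] \<inter> set q" for u v
      using that \<open>\<not> {a, b} \<subseteq> set q\<close> adj_irrefl[of M] by auto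
    then show ?thesis using walk_pts_Int[OF plane succ that(1)] that(2) ab by auto
  qed
  have disj: "?e - {a, b} \<subseteq> - walk_pts M l" "?e - {a, b} \<subseteq> - walk_pts M [v\<^sub>2, v\<^sub>1, v\<^sub>4]"
    "?e - {a, b} \<subseteq> - walk_pts M [v\<^sub>2, v\<^sub>3, v\<^sub>4]"
  proof -
    \<comment> \<open>Since \<open>v\<^sub>2\<close> and \<open>v\<^sub>4\<close> are on the path,
      both ends would be \<open>w\<close>, and there are no loops.\<close>
    have "\<not> {a, b} \<subseteq> {v\<^sub>2, w, v\<^sub>4}" for w
      using assms crossing_path(7,8) adj_irrefl[of M] by auto
    then show "?e - {a, b} \<subseteq> - walk_pts M [v\<^sub>2, v\<^sub>1, v\<^sub>4]" "?e - {a, b} \<subseteq> - walk_pts M [v\<^sub>2, v\<^sub>3, v\<^sub>4]"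
      using small[OF half_boundary(1)] small[OF half_boundary(2)] corners eq
      by (simp_all del: walk_pts.simps) blast+
    show "?e - {a, b} \<subseteq> - walk_pts M l"
      using small[OF crossing_path(10,9)] assms eq by blast
  qed
  have "?e \<subseteq> point_set M" using e(1) by (auto simp: point_set_def)
  then have "?e - {a, b} \<subseteq> inside boundary"
    using inside_boundary disj by blast
  then have cover: "?e - {a, b} \<subseteq> inside ?J1 \<union> inside ?J3"
    using crossing_theta(2) disj(1) by blast
  have con: "connected (?e - {a, b})" using joins_interior_connected[OF e(2)] .
  have clo: "{a, b} \<subseteq> closure (?e - {a, b})"
    using joins_endpoint_closure[OF e(2)]
      joins_endpoint_closure[OF e(2)[unfolded joins_commute[of _ a b]]] by (simp add: insert_commute)
  have fin: "{a, b} \<subseteq> J \<union> inside J" if "?e - {a, b} \<subseteq> inside J" "closed J" for J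
    using clo closure_mono[OF that(1)] closure_inside_subset[OF that(2)] by blast
  have "?e - {a, b} \<subseteq> inside ?J1 \<or> ?e - {a, b} \<subseteq> inside ?J3"
    using con cover crossing_theta(1) open_inside[OF closed_crossing_curve(1)]
      open_inside[OF closed_crossing_curve(2)] unfolding connected_def by blast
  then show ?thesis
  proof
    assume "?e - {a, b} \<subseteq> inside ?J1"
    then show ?thesis
      using fin[OF _ closed_crossing_curve(1)] crossing_curve_verts(1) ab assms(2,3)
      unfolding side1_def by auto
  next
    assume "?e - {a, b} \<subseteq> inside ?J3"
    then show ?thesis
      using fin[OF _ closed_crossing_curve(2)] crossing_curve_verts(2) ab assms(2,3)
      unfolding side3_def by auto
  qed
qed

text \<open>Exactly what \<open>colourings_swap\<close> asks for: the colours met on leaving a side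
  are colours of the path.\<close>

lemma leaves_side:
  assumes "adj M a b"
  shows "a \<in> side1 l \<Longrightarrow> b \<notin> side1 l \<Longrightarrow> b \<in> set l" "a \<in> side3 l \<Longrightarrow> b \<notin> side3 l \<Longrightarrow> b \<in> set l"
  using edge_on_one_side[OF assms] sides_disjoint by blast+

end

section \<open>Two crossing paths with common ends only\<close>

text \<open>One vertex of \<open>q\<close> strictly inside the \<open>v\<^sub>3\<close> curve of
  \<open>p\<close> draws the whole of \<open>q\<close> without its ends there, since
  \<open>q\<close> cannot cross that curve. So the \<open>v\<^sub>3\<close> curve of
  \<open>q\<close> is nested in that of \<open>p\<close>, and its inside misses
  \<open>p\<close>.\<close>

lemma not_on_far_side:
  assumes p: "crossing p" and q: "crossing q" and disj: "set p \<inter> set q = {v\<^sub>2, v\<^sub>4}"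
    and y: "y \<in> set q" "y \<in> inside (cycle_curve M (v\<^sub>3 # p))"
    and x: "x \<in> set p"
  shows "x \<notin> side3 q"
proof -
  let ?J = "cycle_curve M (v\<^sub>3 # p)"
  obtain c where c: "simple_path c" "pathfinish c = pathstart c" "path_image c = ?J"
    using joins_Un_simple_closed[OF crossing_joins(3)[OF p] crossing_joins(1)[OF p] crossing_Int(3)[OF p]]
    unfolding crossing_curve[OF p] by metis
  have pq: "walk_pts M p \<inter> walk_pts M q = {v\<^sub>2, v\<^sub>4}"
    using walk_pts_Int[OF plane crossing_path(10)[OF p] crossing_path(10)[OF q]
        crossing_path(9)[OF p] crossing_path(9)[OF q]] ends_nonadj disj by auto
  have "y \<notin> ?J" using y(2) inside_no_overlap[of ?J] by blast
  moreover have "{v\<^sub>2, v\<^sub>4} \<subseteq> ?J"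
    using crossing_curve_verts(2)[OF p] crossing_path(7,8)[OF p] by auto
  ultimately have y': "y \<in> walk_pts M q - {v\<^sub>2, v\<^sub>4}"
    using y(1) set_subset_walk_pts[of q M] by blast
  have "walk_pts M q - {v\<^sub>2, v\<^sub>4} \<subseteq> inside ?J"
  proof (rule connected_subset_inside)
    show "connected (walk_pts M q - {v\<^sub>2, v\<^sub>4})"
      using joins_interior_connected[OF crossing_joins(1)[OF q]] .
    show "(walk_pts M q - {v\<^sub>2, v\<^sub>4}) \<inter> ?J = {}"
      using pq crossing_Int(3)[OF q] unfolding crossing_curve[OF p] by blast
    show "(walk_pts M q - {v\<^sub>2, v\<^sub>4}) \<inter> inside ?J \<noteq> {}" using y' y(2) by blast
  qed
  then have "cycle_curve M (v\<^sub>3 # q) \<subseteq> ?J \<union> inside ?J"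
    using \<open>{v\<^sub>2, v\<^sub>4} \<subseteq> ?J\<close> unfolding crossing_curve[OF p] crossing_curve[OF q] by blast
  then have "inside (cycle_curve M (v\<^sub>3 # q)) \<inter> ?J = {}"
    using nested_Jordan_curve[OF c(1,2) closed_crossing_curve(2)[OF q]] c(3) by simp
  moreover have "x \<in> ?J" using crossing_curve_verts(2)[OF p] x by auto
  moreover have "x \<noteq> v\<^sub>3" using x crossing_path(6)[OF p] by auto
  ultimately show ?thesis unfolding side3_def by blast
qed

section \<open>The double interchange\<close>

lemma Kempe_double_swap:
  assumes f: "f \<in> colourings M" "f v\<^sub>1 = 1" "f v\<^sub>2 = 2" "f v\<^sub>3 = 1" "f v\<^sub>4 = 2"
    and p: "p \<in> module_paths M f 3 v\<^sub>2 v\<^sub>4" and q: "q \<in> module_paths M f 4 v\<^sub>2 v\<^sub>4"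
    and near: "verts (side_subgraph M v\<^sub>1 p) \<inter> (set q - {v\<^sub>2, v\<^sub>4}) = {}"
    and far: "verts (side_subgraph M v\<^sub>3 p) \<inter> (set q - {v\<^sub>2, v\<^sub>4}) \<noteq> {}"
    and deg: "deg M v\<^sub>2 = 4"
  shows "\<exists>k\<in>colourings M. k v\<^sub>2 \<noteq> k v\<^sub>4"
proof -
  have cp: "crossing p" and fp: "f ` set p \<subseteq> {2, 3}" and cq: "crossing q" and fq: "f ` set q \<subseteq> {2, 4}"
    using p q f by (auto simp: crossing_def module_paths_def)
  note path = crossing_path[OF cp] crossing_path[OF cq]
  note sides = sides_disjoint[OF cp] sides_disjoint[OF cq]
  have near': "verts M \<inter> (set (v\<^sub>1 # p) \<union> inside (cycle_curve M (v\<^sub>1 # p))) \<inter> (set q - {v\<^sub>2, v\<^sub>4}) = {}"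
    and far': "verts M \<inter> (set (v\<^sub>3 # p) \<union> inside (cycle_curve M (v\<^sub>3 # p))) \<inter> (set q - {v\<^sub>2, v\<^sub>4}) \<noteq> {}"
    using near far by (simp_all add: side_subgraph_def induced_subgraph_def)
  \<comment> \<open>The side subgraph at \<open>v\<^sub>1\<close> contains \<open>p\<close> itself,
    so avoiding it keeps the inner vertices of \<open>q\<close> off \<open>p\<close>.\<close>
  have pq: "set p \<inter> set q = {v\<^sub>2, v\<^sub>4}"
    using near' path by auto
  have near_q: "side1 p \<inter> set q = {}"
    using near' sides(2) path unfolding side1_def by auto
  \<comment> \<open>An inner vertex of \<open>q\<close> is neither on \<open>p\<close> nor equal to
    \<open>v\<^sub>3\<close>, so the one given by \<open>far'\<close> lies strictly inside.\<close>
  obtain z where z: "z \<in> set q" "z \<in> inside (cycle_curve M (v\<^sub>3 # p))"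
    using far' pq path by auto
  obtain x r where x: "p = v\<^sub>2 # x # r" "adj M v\<^sub>2 x" "x \<notin> {v\<^sub>1, v\<^sub>2, v\<^sub>3, v\<^sub>4}"
    using crossing_decompose[OF cp] by (metis DiffD2)
  obtain y s where y: "q = v\<^sub>2 # y # s" "adj M v\<^sub>2 y" "y \<notin> {v\<^sub>1, v\<^sub>2, v\<^sub>3, v\<^sub>4}"
    using crossing_decompose[OF cq] by (metis DiffD2)
  have proper: "f u \<noteq> f v" if "adj M u v" for u v using that f(1) by (auto simp: colourings_def)
  have fx: "f x = 3" "f y = 4" using proper[OF x(2)] proper[OF y(2)] fp fq x y f by auto
  have nbrs: "{u. adj M v\<^sub>2 u} = {v\<^sub>1, v\<^sub>3, x, y}"
  proof -
    have "finite {u. adj M v\<^sub>2 u}"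
      using plane by (auto simp: plane_graph_def adj_def intro: rev_finite_subset)
    moreover have "{v\<^sub>1, v\<^sub>3, x, y} \<subseteq> {u. adj M v\<^sub>2 u}"
      using adjs adj_commute[of M] x y by auto
    \<comment> \<open>The successors \<open>x\<close> and \<open>y\<close> differ because their
      colours are 3 and 4. Four known neighbours exhaust the degree.\<close>
    moreover have "card {v\<^sub>1, v\<^sub>3, x, y} = 4"
      using distinct x(3) y(3) fx by (auto simp: card_insert_if)
    ultimately show ?thesis using deg card_subset_eq unfolding deg_def by metis
  qed
  define g where "g v = (if v \<in> side1 p then Transposition.transpose 1 4 (f v) else f v)" for v
  have g: "g \<in> colourings M"
    unfolding g_def
  proof (rule colourings_swap[OF f(1)])
    fix u v assume "adj M u v" "u \<in> side1 p" "v \<notin> side1 p"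
    then have "v \<in> set p" using leaves_side(1)[OF cp] by blast
    then show "f v \<noteq> 1 \<and> f v \<noteq> 4" using fp by auto
  qed (use sides_verts[OF cp] in auto)
  define h where "h v = (if v \<in> side3 q then Transposition.transpose 1 3 (g v) else g v)" for v
  have h: "h \<in> colourings M"
    unfolding h_def
  proof (rule colourings_swap[OF g])
    fix u v assume "adj M u v" "u \<in> side3 q" "v \<notin> side3 q"
    then have v: "v \<in> set q" using leaves_side(2)[OF cq] by blast
    \<comment> \<open>The first interchange does not touch \<open>q\<close>, so \<open>q\<close>
      still carries only the colours 2 and 4 when the second is made.\<close>
    then have "g v = f v" using near_q by (auto simp: g_def)
    with v show "g v \<noteq> 1 \<and> g v \<noteq> 3" using fq by auto
  qed (use sides_verts[OF cq] in auto)
  \<comment> \<open>Here the paths being parallel is decisive: otherwise the second interchange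
    could turn the colour 3 of \<open>x\<close> into 1.\<close>
  have "x \<notin> side3 q" using not_on_far_side[OF cp cq pq z] x by auto
  then have "h v\<^sub>1 = 4" "h v\<^sub>3 = 3" "h x = 3" "h y = 4" "h v\<^sub>4 = 2"
    using sides near_q x(1) y(1) path f fx
    by (auto simp: h_def g_def side1_def side3_def)
  then have free: "h u \<noteq> 1" if "adj M v\<^sub>2 u" for u
  proof -
    have "u \<in> {v\<^sub>1, v\<^sub>3, x, y}" using that nbrs by blast
    then show ?thesis
      using \<open>h v\<^sub>1 = 4\<close> \<open>h v\<^sub>3 = 3\<close> \<open>h x = 3\<close> \<open>h y = 4\<close> by auto
  qed
  have "h(v\<^sub>2 := 1) \<in> colourings M"
  proof -
    have "h(v\<^sub>2 := 1) \<in> verts M \<rightarrow>\<^sub>E {1, 2, 3, 4}"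
      using h corners(2) by (auto simp: colourings_def PiE_iff extensional_def)
    moreover have "(h(v\<^sub>2 := 1)) u \<noteq> (h(v\<^sub>2 := 1)) v" if "adj M u v" for u v
      using that h free[of u] free[of v] adj_commute[of M u v] adj_irrefl[of M u]
      by (cases "u = v\<^sub>2"; cases "v = v\<^sub>2") (auto simp: colourings_def)
    ultimately show ?thesis by (simp add: colourings_def)
  qed
  moreover have "(h(v\<^sub>2 := 1)) v\<^sub>2 \<noteq> (h(v\<^sub>2 := 1)) v\<^sub>4"
    using \<open>h v\<^sub>4 = 2\<close> distinct by auto
  ultimately show ?thesis by blast
qed

end

section \<open>From the outer face to the quadrangle\<close>

text \<open>The unbounded face has the 4-cycle as its frontier, so it is the whole outside of that
  curve; as a face it contains no point of the drawing.\<close>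

lemma SMPG_quadrangle:
  assumes "SMPG M [v\<^sub>1, v\<^sub>2, v\<^sub>3, v\<^sub>4]" "\<not> adj M v\<^sub>2 v\<^sub>4"
  shows "quadrangle M v\<^sub>1 v\<^sub>2 v\<^sub>3 v\<^sub>4"
proof -
  let ?A = "walk_pts M [v\<^sub>2, v\<^sub>1, v\<^sub>4]" and ?B = "walk_pts M [v\<^sub>2, v\<^sub>3, v\<^sub>4]"
  obtain F where F: "\<not> bounded F" "F \<in> faces M" "is_cycle M [v\<^sub>1, v\<^sub>2, v\<^sub>3, v\<^sub>4]"
    "frontier F = cycle_curve M [v\<^sub>1, v\<^sub>2, v\<^sub>3, v\<^sub>4]" and plane: "plane_graph M"
    using assms(1) unfolding SMPG_def semi_maximal_at_def bounded_by_def by blast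
  have dist: "distinct [v\<^sub>1, v\<^sub>2, v\<^sub>3, v\<^sub>4]"
    and adjs: "adj M v\<^sub>1 v\<^sub>2" "adj M v\<^sub>2 v\<^sub>3" "adj M v\<^sub>3 v\<^sub>4" "adj M v\<^sub>4 v\<^sub>1"
    using F(3) by (auto simp: is_cycle_def)
  then have verts: "{v\<^sub>1, v\<^sub>2, v\<^sub>3, v\<^sub>4} \<subseteq> verts M" by (auto simp: adj_def)
  have paths: "is_path M [v\<^sub>2, v\<^sub>1, v\<^sub>4]" "is_path M [v\<^sub>2, v\<^sub>3, v\<^sub>4]"
    using dist adjs verts adj_commute[of M] by (auto simp: is_path_def)
  have joins: "joins ?A v\<^sub>2 v\<^sub>4" "joins ?B v\<^sub>2 v\<^sub>4"
    using joins_walk_pts[OF plane paths(1)] joins_walk_pts[OF plane paths(2)]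
    by (simp_all del: walk_pts.simps)
  have common: "set [v\<^sub>2, v\<^sub>1, v\<^sub>4] \<inter> set [v\<^sub>2, v\<^sub>3, v\<^sub>4] = {v\<^sub>2, v\<^sub>4}"
    using dist by auto
  have "\<not> adj M u v" if "u \<in> {v\<^sub>2, v\<^sub>4}" "v \<in> {v\<^sub>2, v\<^sub>4}" for u v
    using that assms(2) adj_commute[of M] adj_irrefl[of M] by auto
  \<comment> \<open>The only common vertices are not adjacent, so the two halves share no edge and
    together form a simple closed curve.\<close>
  then have "?A \<inter> ?B = {v\<^sub>2, v\<^sub>4}"
    using walk_pts_Int[OF plane, of "[v\<^sub>2, v\<^sub>1, v\<^sub>4]" "[v\<^sub>2, v\<^sub>3, v\<^sub>4]"] paths common
    unfolding is_path_def by metis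
  then obtain c where c: "simple_path c" "pathfinish c = pathstart c" "path_image c = ?A \<union> ?B"
    using joins_Un_simple_closed[OF joins] by metis
  have sub: "?A \<union> ?B \<subseteq> point_set M"
    using walk_pts_subset_point_set[of "[v\<^sub>2, v\<^sub>1, v\<^sub>4]" M]
      walk_pts_subset_point_set[of "[v\<^sub>2, v\<^sub>3, v\<^sub>4]" M] verts by (simp del: walk_pts.simps)
  have frontier: "frontier F = path_image c"
    using F(4) cycle_curve_Cons[of "[v\<^sub>2, v\<^sub>3, v\<^sub>4]" M v\<^sub>1] c(3) by (simp del: walk_pts.simps)
  have "closed e" if "e \<in> edges M" for e
    using plane_edge_ends[OF plane that] joins_closed by blast
  moreover have "finite (verts M)" "finite (edges M)"
    using plane by (simp_all add: plane_graph_def)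
  ultimately have "closed (point_set M)"
    unfolding point_set_def by (intro closed_Un closed_Union finite_imp_closed) auto
  with F(2) have "open F"
    using open_components[of "- point_set M"] unfolding faces_def by (auto simp: closed_def)
  then have "F = outside (?A \<union> ?B)"
    using unbounded_component_eq_outside[OF c(1,2), of "point_set M" F] sub F(1,2) c(3) frontier
    unfolding faces_def by (simp del: walk_pts.simps)
  moreover have "F \<inter> point_set M = {}"
    using F(2) in_components_subset unfolding faces_def by blast
  ultimately show ?thesis
    using plane dist adjs assms(2) by unfold_locales auto
qed

theorem theorem8:
  fixes M :: pgraph and v\<^sub>1 v\<^sub>2 v\<^sub>3 v\<^sub>4 :: complex
    and f :: "complex \<Rightarrow> nat" and l23 l24 :: "complex list"
  assumes "base_module4 M [v\<^sub>1, v\<^sub>2, v\<^sub>3, v\<^sub>4]"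
    and "module_colouring M [v\<^sub>1, v\<^sub>2, v\<^sub>3, v\<^sub>4] f"
    and "f v\<^sub>2 = 2" and "f v\<^sub>4 = 2" and "f v\<^sub>1 = 1" and "f v\<^sub>3 = 1"
    and "l23 \<in> module_paths M f 3 v\<^sub>2 v\<^sub>4"
    and "l24 \<in> module_paths M f 4 v\<^sub>2 v\<^sub>4"
    and "parallel M v\<^sub>1 v\<^sub>2 v\<^sub>3 v\<^sub>4 l23 l24"
    and "deg M v\<^sub>2 = 4"
  shows "\<exists>K\<in>C40 M. \<forall>f'\<in>K. f' v\<^sub>2 \<noteq> f' v\<^sub>4"
proof -
  obtain G\<^sub>1 g where g: "g \<in> colourings (graph_union M G\<^sub>1)" "f = restrict g (verts M)"
    using assms(2) unfolding module_colouring_def UBC_colouring_def by blast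
  \<comment> \<open>Every adjacency of \<open>M\<close> is one of the union, so the restriction is
    again proper.\<close>
  have f: "f \<in> colourings M"
    using g by (auto simp: colourings_def graph_union_def adj_def PiE_iff)
  then have "adj M v\<^sub>2 v\<^sub>4 \<Longrightarrow> f v\<^sub>2 \<noteq> f v\<^sub>4" by (simp add: colourings_def)
  then have "\<not> adj M v\<^sub>2 v\<^sub>4" using assms(3,4) by auto
  then interpret quadrangle M v\<^sub>1 v\<^sub>2 v\<^sub>3 v\<^sub>4
    using assms(1) SMPG_quadrangle by (simp add: base_module4_def)
  have "\<exists>k\<in>colourings M. k v\<^sub>2 \<noteq> k v\<^sub>4"
    using assms(9) unfolding parallel_def Let_def
  proof (elim disjE conjE)
    show ?thesis if "verts (side_subgraph M v\<^sub>1 l23) \<inter> (set l24 - {v\<^sub>2, v\<^sub>4}) = {}"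
      "verts (side_subgraph M v\<^sub>3 l23) \<inter> (set l24 - {v\<^sub>2, v\<^sub>4}) \<noteq> {}"
      using Kempe_double_swap[OF f assms(5,3,6,4,7,8) that assms(10)] .
    \<comment> \<open>The mirror image: \<open>v\<^sub>1\<close> and \<open>v\<^sub>3\<close>
      exchange roles, which is harmless as both have colour 1.\<close>
    show ?thesis if "verts (side_subgraph M v\<^sub>3 l23) \<inter> (set l24 - {v\<^sub>2, v\<^sub>4}) = {}"
      "verts (side_subgraph M v\<^sub>1 l23) \<inter> (set l24 - {v\<^sub>2, v\<^sub>4}) \<noteq> {}"
      using quadrangle.Kempe_double_swap[OF swapped f assms(6,3,5,4,7,8) that assms(10)] .
  qed
  then show ?thesis
    using C40_separates corners by blast
qed

end
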